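(* Let $G$ be a finite simple connected graph with maximum degree $\Delta(G)=4$. Suppose that $G$ contains seven distinct vertices $x,y,z,u,v,w,s$ such that $xy,\,xz,\,yz,\,yu,\,zu,\,xv,\,uv,\,vw,\,ws\in E(G)$, with $d_G(y)=d_G(z)=d_G(s)=3$ and $d_G(x)=d_G(u)=d_G(v)=d_G(w)=4$. Let $e=xy$. If $\chi'(G-e)=4$, then $\chi'(G)=4$.
   Context: $d_G(a)$ denotes the degree of the vertex $a$ in $G$. $\chi'(G)$ denotes the chromatic index, the least $k$ such that $G$ has a proper $k$-edge-coloring. $G-e$ is the graph obtained from $G$ by deleting the edge $e$ (keeping all vertices). The listed edges are required to be present; further edges of $G$ among the listed vertices are allowed subject to the degree conditions (the configuration is not required to be induced). *)

theory Defs
  imports "Graph_Theory.Graph_Theory"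
begin

text \<open>
  A finite simple graph is a \<^locale>\<open>pair_graph\<close>: a finite set of vertices with a finite,
  symmetric, irreflexive set of arcs.  The two arcs \<open>(a, b)\<close> and \<open>(b, a)\<close> together
  represent one undirected edge \<open>{a, b}\<close>, so colourings are functions on the latter.
\<close>

definition edges :: "'a pair_pre_digraph \<Rightarrow> 'a set set" where
  "edges G = {{a, b} | a b. (a, b) \<in> parcs G}"

definition vertex_degree :: "'a pair_pre_digraph \<Rightarrow> 'a \<Rightarrow> nat" where
  "vertex_degree G a = card {e \<in> edges G. a \<in> e}"

definition max_degree :: "'a pair_pre_digraph \<Rightarrow> nat" where
  "max_degree G = Max (vertex_degree G ` pverts G)"

definition del_edge :: "'a pair_pre_digraph \<Rightarrow> 'a set \<Rightarrow> 'a pair_pre_digraph" where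
  "del_edge G e = \<lparr>pverts = pverts G, parcs = {(a, b) \<in> parcs G. {a, b} \<noteq> e}\<rparr>"

definition proper_edge_coloring :: "'a pair_pre_digraph \<Rightarrow> nat \<Rightarrow> ('a set \<Rightarrow> nat) \<Rightarrow> bool" where
  "proper_edge_coloring G k c \<longleftrightarrow>
     c ` edges G \<subseteq> {..<k} \<and>
     (\<forall>e \<in> edges G. \<forall>f \<in> edges G. e \<noteq> f \<and> e \<inter> f \<noteq> {} \<longrightarrow> c e \<noteq> c f)"

definition chromatic_index :: "'a pair_pre_digraph \<Rightarrow> nat" where
  "chromatic_index G = (LEAST k. \<exists>c. proper_edge_coloring G k c)"

lemma edge_iff_arc:
  assumes "pair_graph G"
  shows "{a, b} \<in> edges G \<longleftrightarrow> (a, b) \<in> parcs G"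
proof -
  interpret pair_graph G by fact
  show ?thesis
    unfolding edges_def by (auto simp: doubleton_eq_iff intro: arcs_symmetric)
qed

lemma vertex_degree_eq_out_degree:
  assumes "pair_graph G"
  shows "vertex_degree G a = out_degree (with_proj G) a"
proof -
  interpret pair_graph G by fact
  have "bij_betw (\<lambda>p. {fst p, snd p}) (out_arcs (with_proj G) a) {e \<in> edges G. a \<in> e}"
    unfolding bij_betw_def inj_on_def edges_def out_arcs_def
    by (force simp: doubleton_eq_iff image_iff insert_commute intro: arcs_symmetric)
  then show ?thesis
    by (simp add: vertex_degree_def out_degree_def bij_betw_same_card)
qed

lemma pair_graph_del_edge:
  assumes "pair_graph G"
  shows "pair_graph (del_edge G e)"
proof -
  interpret pair_graph G by fact
  have "finite (parcs (del_edge G e))"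
    by (rule finite_subset[OF _ pair_finite_arcs]) (auto simp: del_edge_def)
  then show ?thesis
    by unfold_locales
       (auto simp: del_edge_def symmetric_def sym_def insert_commute
             dest: in_arcsD1 in_arcsD2 no_loops' intro: arcs_symmetric)
qed

lemma edges_del_edge: "edges (del_edge G e) = edges G - {e}"
  unfolding edges_def del_edge_def by auto

text \<open>The minimum defining the chromatic index is attained.\<close>

lemma chromatic_index_attained:
  assumes "pair_graph G"
  shows "\<exists>c. proper_edge_coloring G (chromatic_index G) c"
proof -
  interpret pair_graph G by fact
  have "edges G = (\<lambda>(a, b). {a, b}) ` parcs G"
    unfolding edges_def by auto
  then have fin: "finite (edges G)"
    using pair_finite_arcs by simp
  then obtain c where "bij_betw c (edges G) {0..<card (edges G)}"
    using ex_bij_betw_finite_nat by blast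
  then have "\<exists>c. proper_edge_coloring G (card (edges G)) c"
    unfolding proper_edge_coloring_def bij_betw_def inj_on_def
    by (intro exI[of _ c]) auto
  then show ?thesis
    unfolding chromatic_index_def by (rule LeastI)
qed

end

theory Submission
  imports Defs "HOL-Combinatorics.Transposition"
begin

text \<open>
  Suppose \<open>G\<close> has no 4-edge-colouring.  In a 4-edge-colouring of \<open>G - xy\<close> every colour missing at
  \<open>x\<close> is seen at \<open>y\<close>, and single-edge recolourings force, up to renaming colours,
  \<open>yz = 0\<close>, \<open>yu = 1\<close>, \<open>xz = 2\<close>, \<open>zu = 3\<close> with \<open>0\<close> missing at \<open>x\<close>.  Such a frame survives
  every Kempe exchange performed outside a union of components that contains the frame edges
  of the two exchanged colours.  For the colours 02 and 13 the chains inside the frame are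
  complete, which allows one to normalise \<open>uv = 0\<close> and \<open>xv = 3\<close>; then the 03-chain from \<open>x\<close> is
  \<open>x v u z y\<close>.  In the other exchanges the chain has two known ends among \<open>x\<close>, \<open>y\<close>, \<open>z\<close>, so it
  avoids the third end \<open>s\<close>.  The exchanges move the pair (colour of \<open>ws\<close>, colour missing at \<open>s\<close>)
  through all its values until \<open>ws\<close> would receive the colour of \<open>vw\<close>.
\<close>

section \<open>Kempe chains\<close>

definition proper :: "'a set set \<Rightarrow> ('a set \<Rightarrow> nat) \<Rightarrow> bool" where
  "proper H c \<longleftrightarrow> (\<forall>f\<in>H. c f < 4) \<and> (\<forall>f\<in>H. \<forall>g\<in>H. f \<noteq> g \<and> f \<inter> g \<noteq> {} \<longrightarrow> c f \<noteq> c g)"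

definition sees :: "'a set set \<Rightarrow> ('a set \<Rightarrow> nat) \<Rightarrow> 'a \<Rightarrow> nat \<Rightarrow> bool" where
  "sees H c a k \<longleftrightarrow> (\<exists>f\<in>H. a \<in> f \<and> c f = k)"

text \<open>For graphs, such a \<open>K\<close> is a union of components of the subgraph formed by
  the edges of colours \<open>i\<close> and \<open>j\<close>. Closedness allows explicit finite sets
  to be used as well as components.\<close>

definition chain_closed :: "'a set set \<Rightarrow> ('a set \<Rightarrow> nat) \<Rightarrow> nat \<Rightarrow> nat \<Rightarrow> 'a set \<Rightarrow> bool" where
  "chain_closed H c i j K \<longleftrightarrow> (\<forall>f\<in>H. c f \<in> {i, j} \<and> f \<inter> K \<noteq> {} \<longrightarrow> f \<subseteq> K)"

text \<open>The Kempe exchange acts outside \<open>K\<close>, so whatever is known inside stays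
  fixed. If \<open>K\<close> is closed, an edge that only meets \<open>K\<close> has neither colour,
  and transposing leaves it alone.\<close>

definition swap_off :: "'a set \<Rightarrow> nat \<Rightarrow> nat \<Rightarrow> ('a set \<Rightarrow> nat) \<Rightarrow> 'a set \<Rightarrow> nat" where
  "swap_off K i j c f = (if f \<subseteq> K then c f else transpose i j (c f))"

definition colour_rel :: "'a set set \<Rightarrow> ('a set \<Rightarrow> nat) \<Rightarrow> nat \<Rightarrow> ('a \<times> 'a) set" where
  "colour_rel H c k = {(a, b). {a, b} \<in> H \<and> c {a, b} = k}"

definition kempe_comp :: "'a set set \<Rightarrow> ('a set \<Rightarrow> nat) \<Rightarrow> nat \<Rightarrow> nat \<Rightarrow> 'a \<Rightarrow> 'a set" where
  "kempe_comp H c i j a = {b. (a, b) \<in> (colour_rel H c i \<union> colour_rel H c j)\<^sup>*}"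

lemma properD:
  "\<lbrakk>proper H c; f \<in> H; g \<in> H; f \<noteq> g; a \<in> f; a \<in> g\<rbrakk> \<Longrightarrow> c f \<noteq> c g"
  unfolding proper_def by blast

lemma seesI: "\<lbrakk>f \<in> H; a \<in> f\<rbrakk> \<Longrightarrow> sees H c a (c f)"
  unfolding sees_def by blast

lemma proper_subset: "\<lbrakk>proper H c; H' \<subseteq> H\<rbrakk> \<Longrightarrow> proper H' c"
  unfolding proper_def by (simp add: subset_iff)

lemma sees_subset: "\<lbrakk>sees H' c a k; H' \<subseteq> H\<rbrakk> \<Longrightarrow> sees H c a k"
  unfolding sees_def by blast

lemma swap_off_in:
  assumes "chain_closed H c i j K" "f \<in> H" "a \<in> f" "a \<in> K"
  shows "swap_off K i j c f = c f"
proof (cases "f \<subseteq> K")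
  case False
  then have "c f \<notin> {i, j}"
    using assms unfolding chain_closed_def by blast
  then show ?thesis
    by (simp add: swap_off_def transpose_def)
qed (simp add: swap_off_def)

lemma swap_off_out:
  "\<lbrakk>a \<in> f; a \<notin> K\<rbrakk> \<Longrightarrow> swap_off K i j c f = transpose i j (c f)"
  by (auto simp: swap_off_def)

text \<open>At a common vertex of two edges, both keep their colours if it lies in \<open>K\<close>,
  and both are transposed otherwise; a transposition is injective.\<close>

lemma proper_swap_off:
  assumes "proper H c" "chain_closed H c i j K" "i < 4" "j < 4"
  shows "proper H (swap_off K i j c)"
  unfolding proper_def
proof (intro conjI ballI impI)
  fix f assume "f \<in> H"
  then show "swap_off K i j c f < 4"
    using assms by (auto simp: proper_def swap_off_def transpose_def)
next
  fix f g assume fg: "f \<in> H" "g \<in> H" "f \<noteq> g \<and> f \<inter> g \<noteq> {}"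
  then obtain a where a: "a \<in> f" "a \<in> g" by blast
  have "c f \<noteq> c g"
    using properD assms(1) fg a by metis
  then show "swap_off K i j c f \<noteq> swap_off K i j c g"
    using swap_off_in[OF assms(2) fg(1) a(1)] swap_off_in[OF assms(2) fg(2) a(2)]
      swap_off_out[OF a(1), of K i j c] swap_off_out[OF a(2), of K i j c]
    by (cases "a \<in> K") (auto simp: transpose_def split: if_splits)
qed

lemma sees_swap_off:
  assumes "chain_closed H c i j K"
  shows "sees H (swap_off K i j c) a k \<longleftrightarrow> sees H c a (if a \<in> K then k else transpose i j k)"
  using swap_off_in[OF assms] unfolding sees_def
  by (auto simp: swap_off_out)

lemma chain_closed_kempe_comp:
  assumes "\<forall>f\<in>H. \<exists>a b. f = {a, b}"
  shows "chain_closed H c i j (kempe_comp H c i j r)"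
  unfolding chain_closed_def
proof (intro ballI impI)
  fix f assume f: "f \<in> H" "c f \<in> {i, j} \<and> f \<inter> kempe_comp H c i j r \<noteq> {}"
  then obtain a b where ab: "f = {a, b}" "a \<in> kempe_comp H c i j r"
    using assms by (metis Int_emptyI insert_commute insertE singletonD)
  have "(a, b) \<in> colour_rel H c i \<union> colour_rel H c j"
    using f ab by (auto simp: colour_rel_def)
  then have "b \<in> kempe_comp H c i j r"
    using ab(2) by (auto simp: kempe_comp_def intro: rtrancl_into_rtrancl)
  then show "f \<subseteq> kempe_comp H c i j r"
    using ab by simp
qed

lemma kempe_comp_self [simp]: "a \<in> kempe_comp H c i j a"
  by (simp add: kempe_comp_def)

text \<open>A component of the union of two matchings is a path or a cycle, so it has at most two
  vertices of degree below two: a shortest path joining two of them is already closed.\<close>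

lemma no_three_ends:
  assumes sym: "sym A" "sym B" and sv: "single_valued A" "single_valued B"
    and ends: "\<And>a. a \<in> {x, y, s} \<Longrightarrow> a \<notin> Domain A \<or> a \<notin> Domain B"
    and dist: "distinct [x, y, s]"
    and xy: "(x, y) \<in> (A \<union> B)\<^sup>*"
  shows "(x, s) \<notin> (A \<union> B)\<^sup>*"
proof
  let ?R = "A \<union> B"
  assume xs: "(x, s) \<in> ?R\<^sup>*"
  define n where "n = (LEAST n. (x, y) \<in> ?R ^^ n)"
  have n: "(x, y) \<in> ?R ^^ n"
    unfolding n_def using rtrancl_imp_relpow[OF xy] by (rule LeastI_ex)
  then obtain f where f0: "f 0 = x" and fn: "f n = y"
    and step: "\<And>i. i < n \<Longrightarrow> (f i, f (Suc i)) \<in> ?R"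
    by (auto simp: relpow_fun_conv)
  have symR: "(b, a) \<in> ?R" if "(a, b) \<in> ?R" for a b
    using that sym by (auto dest: symD)
  have two: "b1 = b2 \<or> b1 = b3 \<or> b2 = b3"
    if "(a, b1) \<in> ?R" "(a, b2) \<in> ?R" "(a, b3) \<in> ?R" for a b1 b2 b3
    using that sv by (auto dest: single_valuedD)
  have one: "b1 = b2" if "(a, b1) \<in> ?R" "(a, b2) \<in> ?R" "a \<in> {x, y, s}" for a b1 b2
    using that(1,2) ends[OF that(3)] sv by (auto dest: single_valuedD)
  have npos: "n \<noteq> 0"
    using f0 fn dist by (metis distinct_length_2_or_more)
  \<comment> \<open>Returning after two steps would allow these steps to be cut out, against the
    minimality of \<open>n\<close>.\<close>
  have turn: "f i \<noteq> f (Suc (Suc i))" if i: "Suc i < n" for i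
  proof
    assume eq: "f i = f (Suc (Suc i))"
    have "(x, f i) \<in> ?R ^^ i"
      unfolding relpow_fun_conv using f0 step i by (intro exI[of _ f]) auto
    moreover have "(f i, y) \<in> ?R ^^ (n - Suc (Suc i))"
      unfolding relpow_fun_conv using fn step eq le_add_diff_inverse[of "Suc (Suc i)" n] i
      by (intro exI[of _ "\<lambda>k. f (Suc (Suc i) + k)"]) auto
    ultimately have "(x, y) \<in> ?R ^^ (i + (n - Suc (Suc i)))"
      by (auto simp: relpow_add)
    moreover have "i + (n - Suc (Suc i)) < n" using i by simp
    ultimately show False
      unfolding n_def using not_less_Least by blast
  qed
  \<comment> \<open>An end of the path has at most one neighbour and an inner vertex at most two.
    The path already supplies them, for inner vertices by \<open>turn\<close>.\<close>
  have closed: "b \<in> f ` {..n}" if a: "a \<in> f ` {..n}" and ab: "(a, b) \<in> ?R" for a b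
  proof -
    obtain i where i: "i \<le> n" "a = f i" using a by auto
    consider "i = 0" | "i = n" | k where "i = Suc k" "Suc k < n"
      using i(1) by (metis le_neq_implies_less not0_implies_Suc)
    then show ?thesis
    proof cases
      case 1
      then have "b = f 1"
        using one[of a b "f 1"] ab step[of 0] npos f0 i by auto
      then show ?thesis using npos by auto
    next
      case 2
      have "(f (n - 1), f n) \<in> ?R"
        using step[of "n - 1"] npos by simp
      then have "b = f (n - 1)"
        using one[of a b "f (n - 1)"] ab fn i 2 symR by auto
      then show ?thesis by auto
    next
      case 3
      have "(a, f k) \<in> ?R"
        using step[of k] 3 i symR by auto
      moreover have "(a, f (Suc (Suc k))) \<in> ?R"
        using step[of "Suc k"] 3 i by auto
      ultimately have "b = f k \<or> b = f (Suc (Suc k))"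
        using two ab turn 3 by metis
      then show ?thesis using 3 by (auto intro!: imageI)
    qed
  qed
  \<comment> \<open>Being on the path but at neither end, \<open>s\<close> has two distinct
    neighbours there, against \<open>one\<close>.\<close>
  have "s \<in> f ` {..n}"
    using xs by (induction rule: rtrancl_induct) (use f0 closed in auto)
  then obtain i where i: "i \<le> n" "s = f i" by auto
  then have "i \<noteq> 0" "i \<noteq> n"
    using f0 fn dist by (metis distinct_length_2_or_more)+
  then obtain k where k: "i = Suc k" "Suc k < n"
    using i(1) not0_implies_Suc by fastforce
  have "(s, f k) \<in> ?R" "(s, f (Suc (Suc k))) \<in> ?R"
    using step[of k] step[of "Suc k"] k i symR by auto
  then show False
    using one[of s] turn k by auto
qed

lemma sym_colour_rel: "sym (colour_rel H c k)"
  by (auto simp: colour_rel_def sym_def insert_commute)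

lemma single_valued_colour_rel:
  assumes "proper H c"
  shows "single_valued (colour_rel H c k)"
proof (rule single_valuedI)
  fix a b b' assume "(a, b) \<in> colour_rel H c k" "(a, b') \<in> colour_rel H c k"
  then show "b = b'"
    using properD[OF assms, of "{a, b}" "{a, b'}" a] by (auto simp: colour_rel_def doubleton_eq_iff)
qed

lemma kempe_comp_third_end:
  assumes "proper H c" "distinct [x, y, s]"
    and "\<And>a. a \<in> {x, y, s} \<Longrightarrow> \<not> sees H c a i \<or> \<not> sees H c a j"
    and "y \<in> kempe_comp H c i j x"
  shows "s \<notin> kempe_comp H c i j x"
proof -
  have "sees H c a k" if "a \<in> Domain (colour_rel H c k)" for a k
    using that by (auto simp: colour_rel_def sees_def)
  then have "a \<notin> Domain (colour_rel H c i) \<or> a \<notin> Domain (colour_rel H c j)"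
    if "a \<in> {x, y, s}" for a
    using assms(3)[OF that] by blast
  from no_three_ends[OF sym_colour_rel sym_colour_rel single_valued_colour_rel
      single_valued_colour_rel this assms(2)] assms(1,4)
  show ?thesis
    unfolding kempe_comp_def by blast
qed

section \<open>Recolouring one edge, renaming colours, missing colours\<close>

lemma proper_recolour:
  assumes "proper (H - {f}) c" "k < 4" "\<And>a. a \<in> f \<Longrightarrow> \<not> sees (H - {f}) c a k"
  shows "proper H (c(f := k))"
  using assms unfolding proper_def sees_def by (auto; blast)


lemma proper_comp:
  assumes "proper H c" "inj_on g {..<4}" "g ` {..<4} \<subseteq> {..<4}"
  shows "proper H (g \<circ> c)"
  using assms(1,3) inj_onD[OF assms(2)] unfolding proper_def by (simp add: image_subset_iff) metis

lemma sees_comp: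
  assumes "proper H c" "inj_on g {..<4}" "k < 4"
  shows "sees H (g \<circ> c) a (g k) \<longleftrightarrow> sees H c a k"
  using assms(1,3) inj_onD[OF assms(2)] unfolding proper_def sees_def by fastforce

lemma missing_colour:
  assumes "finite {f \<in> H. a \<in> f}" "card {f \<in> H. a \<in> f} < 4"
  obtains k where "k < 4" "\<not> sees H c a k"
proof -
  have "card (c ` {f \<in> H. a \<in> f}) < card {..<4::nat}"
    using card_image_le[OF assms(1), of c] assms(2) by simp
  then have "\<not> {..<4} \<subseteq> c ` {f \<in> H. a \<in> f}"
    using card_mono[OF finite_imageI[OF assms(1)], of "{..<4}" c] by linarith
  then show thesis
    using that by (auto simp: sees_def)
qed

section \<open>The configuration\<close>

text \<open>\<open>uncolourable\<close> is the assumption to be refuted. Degree three at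
  \<open>y\<close> and \<open>z\<close> is recorded as the exact set of incident edges, from which
  the colours seen there are read off; the degrees of \<open>x\<close> and \<open>s\<close> enter
  later as missing colours.\<close>

locale uncolourable_config =
  fixes E :: "'a set set" and x y z u v w s :: 'a
  assumes doubletons: "\<forall>f\<in>E. \<exists>a b. f = {a, b}"
    and dist: "distinct [x, y, z, u, v, w, s]"
    and edges_mem: "{x, y} \<in> E" "{x, z} \<in> E" "{y, z} \<in> E" "{y, u} \<in> E" "{z, u} \<in> E"
      "{x, v} \<in> E" "{u, v} \<in> E" "{v, w} \<in> E" "{w, s} \<in> E"
    and at_y: "{f \<in> E. y \<in> f} = {{x, y}, {y, z}, {y, u}}"
    and at_z: "{f \<in> E. z \<in> f} = {{x, z}, {y, z}, {z, u}}"
    and uncolourable: "\<And>c. \<not> proper E c"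
begin

definition H :: "'a set set" where
  "H = E - {{x, y}}"

text \<open>Gives every disequality in the opposite orientation, for the simplifier.\<close>

lemma dist_rev: "distinct [s, w, v, u, z, y, x]"
  using distinct_rev[of "[x, y, z, u, v, w, s]"] dist
  by (simp only: rev.simps append.simps)

lemmas neqs [simp] = dist[simplified] dist_rev[simplified]

lemma mem_H:
  "{x, z} \<in> H" "{y, z} \<in> H" "{y, u} \<in> H" "{z, u} \<in> H"
  "{x, v} \<in> H" "{u, v} \<in> H" "{v, w} \<in> H" "{w, s} \<in> H"
  by (simp_all add: H_def edges_mem doubleton_eq_iff)

lemma sees_y: "sees H c y k \<longleftrightarrow> k = c {y, z} \<or> k = c {y, u}"
proof -
  have "{f \<in> H. y \<in> f} = {f \<in> E. y \<in> f} - {{x, y}}"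
    unfolding H_def by blast
  then have *: "{f \<in> H. y \<in> f} = {{y, z}, {y, u}}"
    by (simp add: at_y insert_Diff_if doubleton_eq_iff)
  have "sees H c y k \<longleftrightarrow> (\<exists>f\<in>{f \<in> H. y \<in> f}. c f = k)"
    unfolding sees_def by blast
  then show ?thesis
    unfolding * by auto
qed

lemma sees_z: "sees H c z k \<longleftrightarrow> k = c {x, z} \<or> k = c {y, z} \<or> k = c {z, u}"
proof -
  have "{f \<in> H. z \<in> f} = {f \<in> E. z \<in> f} - {{x, y}}"
    unfolding H_def by blast
  then have *: "{f \<in> H. z \<in> f} = {{x, z}, {y, z}, {z, u}}"
    by (simp add: at_z insert_Diff_if doubleton_eq_iff)
  have "sees H c z k \<longleftrightarrow> (\<exists>f\<in>{f \<in> H. z \<in> f}. c f = k)"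
    unfolding sees_def by blast
  then show ?thesis
    unfolding * by auto
qed

lemma doubletons_H: "\<forall>f\<in>H. \<exists>a b. f = {a, b}"
  using doubletons unfolding H_def by blast

section \<open>The colours forced near the deleted edge\<close>

text \<open>Otherwise \<open>k\<close> could be given to \<open>xy\<close>, which would colour all
  of \<open>E\<close>.\<close>

lemma sees_y_if_missing_x:
  assumes "proper H c" "k < 4" "\<not> sees H c x k"
  shows "sees H c y k"
  using proper_recolour[OF assms(1)[unfolded H_def] assms(2)] uncolourable assms(3)
  unfolding H_def by blast

lemma recolour_H:
  assumes "proper H c" "f \<in> H" "k < 4" "\<And>a. a \<in> f \<Longrightarrow> \<not> sees H c a k"
  shows "proper H (c(f := k))"
proof (rule proper_recolour)
  show "proper (H - {f}) c"
    by (rule proper_subset[OF assms(1) Diff_subset])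
  show "\<not> sees (H - {f}) c a k" if "a \<in> f" for a
    using assms(4)[OF that] sees_subset[OF _ Diff_subset] by (rule contrapos_nn)
qed (rule assms(3))

text \<open>If \<open>yu\<close> had colour \<open>k\<close>, then \<open>z\<close> would miss
  \<open>k\<close> as well and \<open>xz\<close> could be recoloured \<open>k\<close>. This frees
  the old colour of \<open>xz\<close> at \<open>x\<close>, so \<open>y\<close> must see it,
  necessarily on \<open>yz\<close>; but \<open>yz\<close> and \<open>xz\<close> meet at
  \<open>z\<close>.\<close>

lemma missing_x_yz:
  assumes "proper H c" "\<not> sees H c x k" "k < 4"
  shows "c {y, z} = k"
proof (rule ccontr)
  assume neq: "c {y, z} \<noteq> k"
  then have yu: "c {y, u} = k"
    using sees_y_if_missing_x[OF assms(1,3,2)] sees_y by metis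
  have xz: "c {x, z} \<noteq> k"
    using assms(2) mem_H by (auto simp: sees_def)
  have zu: "c {z, u} \<noteq> k"
    using properD[OF assms(1) mem_H(3,4), of u] yu by (auto simp: doubleton_eq_iff)
  define d where "d = c({x, z} := k)"
  have d: "proper H d"
    unfolding d_def by (rule recolour_H[OF assms(1) mem_H(1) assms(3)])
      (use assms(2) neq xz zu in \<open>auto simp: sees_z\<close>)
  have "\<not> sees H d x (c {x, z})"
  proof
    assume "sees H d x (c {x, z})"
    then obtain f where f: "f \<in> H" "x \<in> f" "d f = c {x, z}"
      unfolding sees_def by blast
    then have "f \<noteq> {x, z}" "c f = c {x, z}"
      using xz unfolding d_def by (auto split: if_splits)
    then show False
      using properD[OF assms(1) f(1) mem_H(1), of x] f by auto
  qed
  then have "sees H d y (c {x, z})"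
    using sees_y_if_missing_x[OF d] assms(1) mem_H by (auto simp: proper_def)
  then have "c {x, z} = c {y, z}"
    unfolding sees_y d_def using yu xz by (auto simp: doubleton_eq_iff)
  then show False
    using properD[OF assms(1) mem_H(1,2), of z] by (auto simp: doubleton_eq_iff)
qed

text \<open>If they agreed, a colour \<open>l\<close> missing at \<open>z\<close> would differ from
  that of \<open>yu\<close>, so \<open>yz\<close> could be recoloured \<open>l\<close>. Then both
  \<open>x\<close> and \<open>y\<close> would miss \<open>k\<close>.\<close>

lemma xz_neq_yu:
  assumes "proper H c" "\<not> sees H c x k" "k < 4"
  shows "c {x, z} \<noteq> c {y, u}"
proof
  assume eq: "c {x, z} = c {y, u}"
  have yz: "c {y, z} = k"
    using missing_x_yz assms by blast
  have "card {c {x, z}, c {y, z}, c {z, u}} \<le> 3"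
    by (simp add: card_insert_if)
  then have "{..<4} - {c {x, z}, c {y, z}, c {z, u}} \<noteq> {}"
    using card_mono[of "{c {x, z}, c {y, z}, c {z, u}}" "{..<4::nat}"] by auto
  then obtain l where l: "l < 4" "l \<notin> {c {x, z}, c {y, z}, c {z, u}}" by auto
  have d: "proper H (c({y, z} := l))"
    by (rule recolour_H[OF assms(1) mem_H(2) l(1)]) (use l(2) eq in \<open>auto simp: sees_y sees_z\<close>)
  have "\<not> sees H (c({y, z} := l)) x k"
    using assms(2) by (auto simp: sees_def split: if_splits)
  then have "sees H (c({y, z} := l)) y k"
    using sees_y_if_missing_x[OF d assms(3)] by blast
  then have "k = c {y, u}"
    using l(2) yz by (auto simp: sees_y doubleton_eq_iff split: if_splits)
  then show False
    using yz properD[OF assms(1) mem_H(2,3), of y] by (auto simp: doubleton_eq_iff)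
qed

section \<open>Frames, states and exchanges with explicit chains\<close>

definition framed :: "('a set \<Rightarrow> nat) \<Rightarrow> bool" where
  "framed c \<longleftrightarrow> proper H c \<and> c {y, z} = 0 \<and> c {y, u} = 1 \<and> c {x, z} = 2 \<and> c {z, u} = 3
     \<and> \<not> sees H c x 0"

text \<open>The arguments are the colours of \<open>xv\<close>, \<open>uv\<close>, \<open>vw\<close>, \<open>ws\<close> and a colour missing at \<open>s\<close>.\<close>

definition state :: "nat \<Rightarrow> nat \<Rightarrow> nat \<Rightarrow> nat \<Rightarrow> nat \<Rightarrow> bool" where
  "state p q r t m \<longleftrightarrow> (\<exists>c. framed c \<and> c {x, v} = p \<and> c {u, v} = q \<and> c {v, w} = r
     \<and> c {w, s} = t \<and> \<not> sees H c s m)"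

lemma state_impossible: "\<not> state p q r r m"
proof
  assume "state p q r r m"
  then obtain c where "proper H c" "c {v, w} = c {w, s}"
    by (auto simp: state_def framed_def)
  then show False
    using properD[of H c "{v, w}" "{w, s}" w] mem_H by (auto simp: doubleton_eq_iff)
qed

lemma framedD:
  assumes "framed c"
  shows "proper H c" "c {y, z} = 0" "c {y, u} = 1" "c {x, z} = 2" "c {z, u} = 3" "\<not> sees H c x 0"
  using assms by (simp_all add: framed_def)

text \<open>All four frame edges meet \<open>y\<close> or \<open>z\<close>, so they keep their
  colours. The condition on \<open>x\<close> keeps colour 0 missing there.\<close>

lemma framed_swap:
  assumes c: "framed c" and K: "chain_closed H c i j K" "y \<in> K" "z \<in> K"
    and x: "x \<in> K \<or> i \<noteq> 0 \<and> j \<noteq> 0" and ij: "i < 4" "j < 4"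
  shows "framed (swap_off K i j c)"
proof -
  note swap = swap_off_in[OF K(1)]
  have "\<not> sees H (swap_off K i j c) x 0"
    using x framedD(6)[OF c] by (auto simp: sees_swap_off[OF K(1)] transpose_def)
  moreover have "proper H (swap_off K i j c)"
    using framedD(1)[OF c] K(1) ij by (rule proper_swap_off)
  ultimately show ?thesis
    unfolding framed_def
    using framedD[OF c] swap[OF mem_H(1), of z] swap[OF mem_H(2), of z] swap[OF mem_H(3), of y]
      swap[OF mem_H(4), of z] K(2,3)
    by simp
qed

text \<open>As \<open>s\<close> lies off \<open>K\<close>, the colour of \<open>ws\<close> and the
  missing colour are transposed together; the three edges at \<open>v\<close> depend on
  \<open>K\<close>.\<close>

lemma state_swap:
  assumes c: "framed c" "\<not> sees H c s m"
    and K: "chain_closed H c i j K" "y \<in> K" "z \<in> K" "s \<notin> K"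
    and x: "x \<in> K \<or> i \<noteq> 0 \<and> j \<noteq> 0" and ij: "i < 4" "j < 4"
  shows "state (swap_off K i j c {x, v}) (swap_off K i j c {u, v}) (swap_off K i j c {v, w})
    (transpose i j (c {w, s})) (transpose i j m)"
proof -
  have "\<not> sees H (swap_off K i j c) s (transpose i j m)"
    using K(4) c(2) by (simp add: sees_swap_off[OF K(1)])
  moreover have "swap_off K i j c {w, s} = transpose i j (c {w, s})"
    using K(4) by (intro swap_off_out[of s]) simp_all
  ultimately show ?thesis
    using framed_swap[OF c(1) K(1,2,3) x ij] unfolding state_def by blast
qed

text \<open>\<open>F\<close> is a certificate: by properness, an edge of colour \<open>i\<close> or
  \<open>j\<close> at a vertex of \<open>K\<close> is the edge of \<open>F\<close> with that colour
  there.\<close>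

lemma chain_closedI:
  assumes "proper H c" "F \<subseteq> H" "\<Union>F \<subseteq> K"
    and "\<And>a k. \<lbrakk>a \<in> K; k \<in> {i, j}\<rbrakk> \<Longrightarrow> \<not> sees H c a k \<or> (\<exists>f\<in>F. a \<in> f \<and> c f = k)"
  shows "chain_closed H c i j K"
  unfolding chain_closed_def
proof (intro ballI impI)
  fix f assume f: "f \<in> H" "c f \<in> {i, j} \<and> f \<inter> K \<noteq> {}"
  then obtain a where a: "a \<in> f" "a \<in> K" by blast
  then have "sees H c a (c f)"
    using f by (auto simp: sees_def)
  then obtain g where "g \<in> F" "a \<in> g" "c g = c f"
    using assms(4)[OF a(2), of "c f"] f(2) by blast
  then have "f \<in> F"
    using properD[OF assms(1) f(1), of g a] a assms(2) by auto
  then show "f \<subseteq> K"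
    using assms(3) by blast
qed

text \<open>The path \<open>x z y\<close> is a full chain: \<open>x\<close> misses 0 and
  \<open>y\<close> misses 2.\<close>

lemma closed_xyz: "framed c \<Longrightarrow> chain_closed H c 0 2 {x, y, z}"
  using mem_H
  by (intro chain_closedI[of _ "{{x, z}, {y, z}}"]) (auto simp: framedD sees_y)

text \<open>The path \<open>y u z\<close> is a full chain: \<open>y\<close> misses 3 and
  \<open>z\<close> misses 1.\<close>

lemma closed_yzu: "framed c \<Longrightarrow> chain_closed H c 1 3 {y, z, u}"
  using mem_H
  by (intro chain_closedI[of _ "{{y, u}, {z, u}}"]) (auto simp: framedD sees_y sees_z)

lemma closed_xyzuv:
  "\<lbrakk>framed c; c {x, v} = 3; c {u, v} = 0\<rbrakk> \<Longrightarrow> chain_closed H c 0 3 {x, y, z, u, v}"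
  using mem_H
  by (intro chain_closedI[of _ "{{y, z}, {z, u}, {u, v}, {x, v}}"]) (auto simp: framedD sees_y)

lemma touching_unchanged:
  assumes "chain_closed H c i j K"
  shows "x \<in> K \<or> v \<in> K \<Longrightarrow> swap_off K i j c {x, v} = c {x, v}"
    and "u \<in> K \<or> v \<in> K \<Longrightarrow> swap_off K i j c {u, v} = c {u, v}"
    and "v \<in> K \<or> w \<in> K \<Longrightarrow> swap_off K i j c {v, w} = c {v, w}"
  using swap_off_in[OF assms] mem_H by auto

lemma state_swap_02:
  assumes "state p q r t m"
  shows "state p (transpose 0 2 q) (transpose 0 2 r) (transpose 0 2 t) (transpose 0 2 m)"
proof -
  obtain c where c: "framed c" "\<not> sees H c s m"
    and vals: "c {x, v} = p" "c {u, v} = q" "c {v, w} = r" "c {w, s} = t"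
    using assms by (auto simp: state_def)
  have K: "chain_closed H c 0 2 {x, y, z}"
    using c(1) by (rule closed_xyz)
  show ?thesis
    using state_swap[OF c K] touching_unchanged(1)[OF K]
    by (simp add: vals swap_off_out[of u] swap_off_out[of v])
qed

lemma state_swap_13:
  assumes "state p q r t m"
  shows "state (transpose 1 3 p) q (transpose 1 3 r) (transpose 1 3 t) (transpose 1 3 m)"
proof -
  obtain c where c: "framed c" "\<not> sees H c s m"
    and vals: "c {x, v} = p" "c {u, v} = q" "c {v, w} = r" "c {w, s} = t"
    using assms by (auto simp: state_def)
  have K: "chain_closed H c 1 3 {y, z, u}"
    using c(1) by (rule closed_yzu)
  show ?thesis
    using state_swap[OF c K] touching_unchanged(2)[OF K]
    by (simp add: vals swap_off_out[of x] swap_off_out[of v])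
qed

lemma state_swap_03:
  assumes "state 3 0 r t m"
  shows "state 3 0 r (transpose 0 3 t) (transpose 0 3 m)"
proof -
  obtain c where c: "framed c" "\<not> sees H c s m"
    and vals: "c {x, v} = 3" "c {u, v} = 0" "c {v, w} = r" "c {w, s} = t"
    using assms by (auto simp: state_def)
  have K: "chain_closed H c 0 3 {x, y, z, u, v}"
    using c(1) vals(1,2) by (rule closed_xyzuv)
  show ?thesis
    using state_swap[OF c K] touching_unchanged[OF K] by (simp add: vals)
qed

section \<open>Exchanges along chains with two known ends\<close>

text \<open>Otherwise the exchange off the chain of \<open>x\<close> turns the 0 seen at
  \<open>y\<close> into 3. Then 0 is missing at both \<open>x\<close> and \<open>y\<close>.\<close>

lemma y_in_comp_x:
  assumes "framed c"
  shows "y \<in> kempe_comp H c 0 3 x"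
proof (rule ccontr)
  let ?K = "kempe_comp H c 0 3 x" and ?d = "swap_off (kempe_comp H c 0 3 x) 0 3 c"
  assume y: "y \<notin> ?K"
  have K: "chain_closed H c 0 3 ?K"
    using doubletons_H by (rule chain_closed_kempe_comp)
  have "proper H ?d"
    using framedD(1)[OF assms] K by (rule proper_swap_off) simp_all
  moreover have "\<not> sees H ?d x 0"
    using framedD(6)[OF assms] by (simp add: sees_swap_off[OF K])
  moreover have "\<not> sees H c y 3"
    using framedD[OF assms] by (simp add: sees_y)
  then have "\<not> sees H ?d y 0"
    using y by (simp add: sees_swap_off[OF K])
  ultimately show False
    using sees_y_if_missing_x[of ?d 0] by simp
qed

text \<open>Otherwise the exchange off the chain of \<open>z\<close> gives \<open>yu\<close> colour
  2 while \<open>xz\<close> keeps it, against \<open>xz_neq_yu\<close>.\<close>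

lemma y_in_comp_z:
  assumes "framed c"
  shows "y \<in> kempe_comp H c 1 2 z"
proof (rule ccontr)
  let ?K = "kempe_comp H c 1 2 z" and ?d = "swap_off (kempe_comp H c 1 2 z) 1 2 c"
  assume y: "y \<notin> ?K"
  have K: "chain_closed H c 1 2 ?K"
    using doubletons_H by (rule chain_closed_kempe_comp)
  have "proper H ?d"
    using framedD(1)[OF assms] K by (rule proper_swap_off) simp_all
  moreover have "\<not> sees H ?d x 0"
    unfolding sees_swap_off[OF K] using framedD(6)[OF assms] by (simp add: transpose_def)
  moreover have "?d {x, z} = 2"
    using swap_off_in[OF K mem_H(1), of z] framedD[OF assms] by simp
  moreover have "?d {y, u} = 2"
    using swap_off_out[of y "{y, u}" ?K] y framedD[OF assms] by simp
  ultimately show False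
    using xz_neq_yu[of ?d 0] by simp
qed

lemma chain_closed_edge:
  "\<lbrakk>chain_closed H c i j K; {a, b} \<in> H; c {a, b} \<in> {i, j}; a \<in> K \<or> b \<in> K\<rbrakk> \<Longrightarrow> a \<in> K \<and> b \<in> K"
  unfolding chain_closed_def by blast

text \<open>The 03-chain of \<open>x\<close> has ends \<open>x\<close> and \<open>y\<close>, so the
  third end \<open>s\<close> avoids it. It contains \<open>v\<close> because \<open>xv\<close> has
  colour 3, so all edges at \<open>v\<close> are fixed.\<close>

lemma comp_x_swap:
  assumes "state 3 2 r t m" "m \<in> {0, 3}"
  shows "state 3 2 r (transpose 0 3 t) (transpose 0 3 m)"
proof -
  obtain c where c: "framed c" "\<not> sees H c s m"
    and vals: "c {x, v} = 3" "c {u, v} = 2" "c {v, w} = r" "c {w, s} = t"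
    using assms by (auto simp: state_def)
  let ?K = "kempe_comp H c 0 3 x"
  have K: "chain_closed H c 0 3 ?K"
    using doubletons_H by (rule chain_closed_kempe_comp)
  have y: "y \<in> ?K"
    using c(1) by (rule y_in_comp_x)
  have "\<not> sees H c a 0 \<or> \<not> sees H c a 3" if "a \<in> {x, y, s}" for a
    using that c assms(2) framedD[OF c(1)] sees_y by auto
  then have s: "s \<notin> ?K"
    using kempe_comp_third_end[OF framedD(1)[OF c(1)] _ _ y] by simp
  have z: "z \<in> ?K"
    using chain_closed_edge[OF K mem_H(2)] framedD[OF c(1)] y by simp
  have u: "u \<in> ?K"
    using chain_closed_edge[OF K mem_H(4)] framedD[OF c(1)] z by simp
  have v: "v \<in> ?K"
    using chain_closed_edge[OF K mem_H(5)] vals by simp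
  show ?thesis
    using state_swap[OF c K y z s] touching_unchanged[OF K] u v by (simp add: vals)
qed

text \<open>The ends are \<open>z\<close>, missing 1, and \<open>y\<close>, missing 2; hence
  \<open>s\<close> lies elsewhere. The edges \<open>xz\<close> and \<open>yu\<close> bring in
  \<open>x\<close> and \<open>u\<close>.\<close>

lemma comp_z:
  assumes "framed c" "\<not> sees H c s m" "m \<in> {1, 2}"
  shows "{x, y, z, u} \<subseteq> kempe_comp H c 1 2 z" "s \<notin> kempe_comp H c 1 2 z"
proof -
  let ?K = "kempe_comp H c 1 2 z"
  have K: "chain_closed H c 1 2 ?K"
    using doubletons_H by (rule chain_closed_kempe_comp)
  have y: "y \<in> ?K"
    using assms(1) by (rule y_in_comp_z)
  have "\<not> sees H c a 1 \<or> \<not> sees H c a 2" if "a \<in> {z, y, s}" for a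
    using that assms(2,3) framedD[OF assms(1)] sees_y sees_z by auto
  then show "s \<notin> ?K"
    using kempe_comp_third_end[OF framedD(1)[OF assms(1)] _ _ y] by simp
  have "x \<in> ?K"
    using chain_closed_edge[OF K mem_H(1)] framedD[OF assms(1)] by simp
  moreover have "u \<in> ?K"
    using chain_closed_edge[OF K mem_H(3)] framedD[OF assms(1)] y by simp
  ultimately show "{x, y, z, u} \<subseteq> ?K"
    using y by simp
qed

lemma comp_z_swap:
  assumes "state 3 2 r t m" "m \<in> {1, 2}"
  shows "state 3 2 r (transpose 1 2 t) (transpose 1 2 m)"
proof -
  obtain c where c: "framed c" "\<not> sees H c s m"
    and vals: "c {x, v} = 3" "c {u, v} = 2" "c {v, w} = r" "c {w, s} = t"
    using assms by (auto simp: state_def)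
  let ?K = "kempe_comp H c 1 2 z"
  have K: "chain_closed H c 1 2 ?K"
    using doubletons_H by (rule chain_closed_kempe_comp)
  note mem = comp_z[OF c assms(2)]
  have v: "v \<in> ?K"
    using chain_closed_edge[OF K mem_H(6)] vals mem by simp
  show ?thesis
    using state_swap[OF c K] touching_unchanged[OF K] mem v by (simp add: vals)
qed

text \<open>With \<open>uv\<close> of colour 0 nothing forces \<open>v\<close> onto the chain.
  Whether it lies there decides if \<open>vw\<close> is exchanged, hence the disjunction.\<close>

lemma comp_z_swap':
  assumes "state 3 0 r t m" "m \<in> {1, 2}"
  shows "state 3 0 r (transpose 1 2 t) (transpose 1 2 m)
    \<or> state 3 0 (transpose 1 2 r) (transpose 1 2 t) (transpose 1 2 m)"
proof -
  obtain c where c: "framed c" "\<not> sees H c s m"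
    and vals: "c {x, v} = 3" "c {u, v} = 0" "c {v, w} = r" "c {w, s} = t"
    using assms by (auto simp: state_def)
  let ?K = "kempe_comp H c 1 2 z"
  have K: "chain_closed H c 1 2 ?K"
    using doubletons_H by (rule chain_closed_kempe_comp)
  note mem = comp_z[OF c assms(2)]
  show ?thesis
    using state_swap[OF c K] touching_unchanged[OF K] mem swap_off_out[of v "{v, w}" ?K 1 2 c]
    by (cases "v \<in> ?K") (simp_all add: vals)
qed

text \<open>The next two exchanges are \<open>comp_x_swap\<close> and \<open>comp_z_swap\<close>, conjugated by the exchange of
  colours 0 and 2, which turns \<open>uv\<close> from colour 0 into colour 2 and back.\<close>

lemma state_swap_23:
  assumes "state 3 0 r t m" "m \<in> {2, 3}"
  shows "state 3 0 r (transpose 2 3 t) (transpose 2 3 m)"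
proof -
  have conj: "transpose 0 2 (transpose 0 3 (transpose 0 2 k)) = transpose 2 3 k" for k :: nat
    by (simp add: transpose_def)
  have "state 3 2 (transpose 0 2 r) (transpose 0 3 (transpose 0 2 t)) (transpose 0 3 (transpose 0 2 m))"
    using state_swap_02[OF assms(1)] assms(2) by (intro comp_x_swap) auto
  from state_swap_02[OF this] show ?thesis
    by (simp only: conj transpose_involutory transpose_apply_second)
qed

lemma state_swap_01:
  assumes "state 3 0 r t m" "m \<in> {0, 1}"
  shows "state 3 0 r (transpose 0 1 t) (transpose 0 1 m)"
proof -
  have conj: "transpose 0 2 (transpose 1 2 (transpose 0 2 k)) = transpose 0 1 k" for k :: nat
    by (simp add: transpose_def)
  have "state 3 2 (transpose 0 2 r) (transpose 1 2 (transpose 0 2 t)) (transpose 1 2 (transpose 0 2 m))"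
    using state_swap_02[OF assms(1)] assms(2) by (intro comp_z_swap) auto
  from state_swap_02[OF this] show ?thesis
    by (simp only: conj transpose_involutory transpose_apply_second)
qed

section \<open>Elimination of all states\<close>

text \<open>Each exchange carries an admissible state to one already excluded; the starting points
  are exchanges that would give \<open>ws\<close> the colour of \<open>vw\<close>.\<close>

lemma no_state_30:
  assumes "r \<in> {1, 2}" "t < 4" "m < 4" "t \<noteq> m"
  shows "\<not> state 3 0 r t m"
proof -
  \<comment> \<open>A fact \<open>btm\<close> or \<open>gtm\<close> excludes \<open>ws = t\<close> with \<open>m\<close> missing at \<open>s\<close>, for \<open>vw\<close> of colour 1 or 2.\<close>
  note S03 = state_swap_03 and S23 = state_swap_23 and S01 = state_swap_01
  \<comment> \<open>The digits of the name \<open>b10\<close> are reversed: here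
    \<open>t = 0\<close> and \<open>m = 1\<close>.\<close>
  have b10: "\<not> state 3 0 1 0 1" using S01[of 1 0 1] state_impossible by auto
  have b31: "\<not> state 3 0 1 3 1" using S03[of 1 3 1] b10 by auto
  have b30: "\<not> state 3 0 1 3 0" using S01[of 1 3 0] b31 by auto
  have b03: "\<not> state 3 0 1 0 3" using S03[of 1 0 3] b30 by auto
  have g32: "\<not> state 3 0 2 3 2" using S23[of 2 3 2] state_impossible by auto
  have g02: "\<not> state 3 0 2 0 2" using S03[of 2 0 2] g32 by auto
  have g03: "\<not> state 3 0 2 0 3" using S23[of 2 0 3] g02 by auto
  have g30: "\<not> state 3 0 2 3 0" using S03[of 2 3 0] g03 by auto
  have g31: "\<not> state 3 0 2 3 1" using S01[of 2 3 1] g30 by auto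
  have g01: "\<not> state 3 0 2 0 1" using S03[of 2 0 1] g31 by auto
  have g10: "\<not> state 3 0 2 1 0" using S01[of 2 1 0] g01 by auto
  have g13: "\<not> state 3 0 2 1 3" using S03[of 2 1 3] g10 by auto
  have g12: "\<not> state 3 0 2 1 2" using S23[of 2 1 2] g13 by auto
  \<comment> \<open>Both outcomes of \<open>comp_z_swap'\<close> are excluded: \<open>b10\<close> if
    \<open>vw\<close> keeps colour 1, \<open>g01\<close> if it becomes 2.\<close>
  have b02: "\<not> state 3 0 1 0 2" using comp_z_swap'[of 1 0 2] b10 g01 by auto
  have b32: "\<not> state 3 0 1 3 2" using S03[of 1 3 2] b02 by auto
  have b23: "\<not> state 3 0 1 2 3" using S23[of 1 2 3] b32 by auto
  have b20: "\<not> state 3 0 1 2 0" using S03[of 1 2 0] b23 by auto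
  have b21: "\<not> state 3 0 1 2 1" using S01[of 1 2 1] b20 by auto
  have "t \<in> {0, 1, 2, 3}" "m \<in> {0, 1, 2, 3}"
    using assms(2,3) by auto
  then show ?thesis
    using assms(1,4) b10 b31 b30 b03 g32 g02 g03 g30 g31 g01 g10 g13 g12 b02 b32 b23 b20 b21
      state_impossible by auto
qed

lemma transpose_less_4: "\<lbrakk>i < 4; j < 4; k < 4\<rbrakk> \<Longrightarrow> transpose i j k < (4 :: nat)"
  by (simp add: transpose_def)

text \<open>The 02-exchange fixes \<open>xv\<close> and reduces \<open>q = 2\<close> to
  \<open>q = 0\<close>.\<close>

lemma no_state_3:
  assumes "q \<in> {0, 2}" "r < 4" "r \<noteq> 3" "r \<noteq> q" "t < 4" "m < 4" "t \<noteq> m"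
  shows "\<not> state 3 q r t m"
proof (cases "q = 0")
  case True
  then have "r \<in> {1, 2}"
    using assms(2-4) by auto
  then show ?thesis
    using no_state_30[of r t m] assms(5-7) True by simp
next
  case False
  then have q: "q = 2" using assms(1) by simp
  have "r \<in> {0, 1}" using assms(2-4) q by auto
  then have "transpose 0 2 r \<in> {1, 2}" by auto
  moreover have "transpose 0 2 t \<noteq> transpose 0 2 m"
    using assms(7) by (rule contrapos_nn) (rule transpose_eq_imp_eq)
  ultimately have "\<not> state 3 0 (transpose 0 2 r) (transpose 0 2 t) (transpose 0 2 m)"
    using assms(5,6) by (intro no_state_30 transpose_less_4) simp_all
  then show ?thesis
    using state_swap_02[of 3 2 r t m] q by auto
qed

text \<open>The 13-exchange fixes \<open>uv\<close> and reduces \<open>p = 1\<close> to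
  \<open>p = 3\<close>.\<close>

lemma no_state:
  assumes "p \<in> {1, 3}" "q \<in> {0, 2}" "r < 4" "r \<noteq> p" "r \<noteq> q" "t < 4" "m < 4" "t \<noteq> m"
  shows "\<not> state p q r t m"
proof (cases "p = 3")
  case True
  then show ?thesis
    using no_state_3[of q r t m] assms by simp
next
  case False
  then have p: "p = 1" using assms(1) by simp
  have "transpose 1 3 r \<noteq> 3" "transpose 1 3 r \<noteq> q"
    using assms(2,4,5) p by (auto simp: transpose_def)
  moreover have "transpose 1 3 t \<noteq> transpose 1 3 m"
    using assms(8) by (rule contrapos_nn) (rule transpose_eq_imp_eq)
  ultimately have "\<not> state 3 q (transpose 1 3 r) (transpose 1 3 t) (transpose 1 3 m)"
    using assms(2,3,6,7) by (intro no_state_3 transpose_less_4) simp_all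
  then show ?thesis
    using state_swap_13[of 1 q r t m] p by auto
qed

text \<open>The frame leaves only 1, 3 for \<open>xv\<close> and 0, 2 for \<open>uv\<close>, so
  every framed colouring realises a state excluded by \<open>no_state\<close>.\<close>

lemma not_framed:
  assumes c: "framed c" and m: "m < 4" "\<not> sees H c s m"
  shows False
proof -
  note P = framedD(1)[OF c]
  have less: "c f < 4" if "f \<in> H" for f
    using P that by (simp add: proper_def)
  have "c {x, v} \<noteq> 2"
    using properD[OF P mem_H(5,1), of x] framedD[OF c] by (simp add: doubleton_eq_iff)
  moreover have "c {x, v} \<noteq> 0"
    using framedD(6)[OF c] seesI[OF mem_H(5), of x c] by (cases "c {x, v} = 0") simp_all
  ultimately have p: "c {x, v} \<in> {1, 3}"
    using less[OF mem_H(5)] by auto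
  have "c {u, v} \<noteq> 1" "c {u, v} \<noteq> 3"
    using properD[OF P mem_H(6,3), of u] properD[OF P mem_H(6,4), of u] framedD[OF c]
    by (simp_all add: doubleton_eq_iff)
  then have q: "c {u, v} \<in> {0, 2}"
    using less[OF mem_H(6)] by auto
  have r: "c {v, w} \<noteq> c {x, v}" "c {v, w} \<noteq> c {u, v}"
    using properD[OF P mem_H(7,5), of v] properD[OF P mem_H(7,6), of v]
    by (simp_all add: doubleton_eq_iff)
  have t: "c {w, s} \<noteq> m"
    using m(2) seesI[OF mem_H(8), of s c] by auto
  have "state (c {x, v}) (c {u, v}) (c {v, w}) (c {w, s}) m"
    unfolding state_def by (intro exI[of _ c]) (simp add: c m(2))
  then show False
    using no_state[OF p q less[OF mem_H(7)] r less[OF mem_H(8)] m(1) t] by contradiction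
qed

lemma no_proper_colouring_H:
  assumes c: "proper H c" and k: "k < 4" "\<not> sees H c x k" and m: "m < 4" "\<not> sees H c s m"
  shows False
proof -
  have less: "c f < 4" if "f \<in> H" for f
    using c that by (simp add: proper_def)
  have yz: "c {y, z} = k"
    using c k(2,1) by (rule missing_x_yz)
  \<comment> \<open>This renaming produces the frame; the default value 3 is meant for the colour of
    \<open>zu\<close>.\<close>
  define g where "g i = (if i = k then 0 else if i = c {y, u} then 1
    else if i = c {x, z} then 2 else (3 :: nat))" for i
  have "c {y, z} \<noteq> c {y, u}" "c {y, z} \<noteq> c {x, z}" "c {y, z} \<noteq> c {z, u}"
    "c {y, u} \<noteq> c {z, u}" "c {x, z} \<noteq> c {z, u}"
    using properD[OF c mem_H(2,3), of y] properD[OF c mem_H(2,1), of z]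
      properD[OF c mem_H(2,4), of z] properD[OF c mem_H(3,4), of u] properD[OF c mem_H(1,4), of z]
    by (simp_all add: doubleton_eq_iff)
  then have neq: "k \<noteq> c {y, u}" "k \<noteq> c {x, z}" "k \<noteq> c {z, u}"
    "c {y, u} \<noteq> c {z, u}" "c {x, z} \<noteq> c {z, u}" "c {x, z} \<noteq> c {y, u}"
    using yz xz_neq_yu[OF c k(2,1)] by simp_all
  have "{k, c {y, u}, c {x, z}, c {z, u}} = {..<4}"
  proof (rule card_subset_eq)
    show "{k, c {y, u}, c {x, z}, c {z, u}} \<subseteq> {..<4}"
      using k(1) less[OF mem_H(1)] less[OF mem_H(3)] less[OF mem_H(4)] by simp
    show "card {k, c {y, u}, c {x, z}, c {z, u}} = card {..<4::nat}"
      using neq neq[symmetric] by simp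
  qed simp
  moreover have "inj_on g {k, c {y, u}, c {x, z}, c {z, u}}"
    using neq neq[symmetric] by (simp add: inj_on_def g_def)
  ultimately have inj: "inj_on g {..<4}"
    by (rule subst)
  have "framed (g \<circ> c)"
    unfolding framed_def
  proof (intro conjI)
    show "proper H (g \<circ> c)"
      using c inj by (rule proper_comp) (auto simp: g_def)
    show "\<not> sees H (g \<circ> c) x 0"
      using sees_comp[OF c inj k(1), of x] k(2) by (simp add: g_def)
  qed (use yz neq neq[symmetric] in \<open>simp_all add: g_def\<close>)
  moreover have "g m < 4"
    by (simp add: g_def)
  moreover have "\<not> sees H (g \<circ> c) s (g m)"
    using sees_comp[OF c inj m(1)] m(2) by simp
  ultimately show False
    by (rule not_framed)
qed

end

section \<open>Return to graphs and the chromatic index\<close>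

lemma proper_edge_coloring_4: "proper_edge_coloring G 4 c \<longleftrightarrow> proper (edges G) c"
  by (auto simp: proper_edge_coloring_def proper_def image_subset_iff)

lemma incident_edges_eq:
  assumes "distinct [a, b1, b2, b3]" "{a, b1} \<in> E" "{a, b2} \<in> E" "{a, b3} \<in> E"
    and "card {f \<in> E. a \<in> f} = 3"
  shows "{f \<in> E. a \<in> f} = {{a, b1}, {a, b2}, {a, b3}}"
proof (rule card_subset_eq[symmetric])
  show "finite {f \<in> E. a \<in> f}"
    using assms(5) by (intro card_ge_0_finite) simp
  show "card {{a, b1}, {a, b2}, {a, b3}} = card {f \<in> E. a \<in> f}"
    using assms(1,5) by (simp add: doubleton_eq_iff)
qed (use assms(2-4) in simp)

theorem proposition2p15:
  fixes G :: "'a pair_pre_digraph"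
    and x y z u v w s :: 'a
    and e :: "'a set"
  assumes "pair_graph G"
    and "connected (with_proj G)"
    and "max_degree G = 4"
    and "{x, y, z, u, v, w, s} \<subseteq> pverts G"
    and "distinct [x, y, z, u, v, w, s]"
    and "{x, y} \<in> edges G" "{x, z} \<in> edges G" "{y, z} \<in> edges G"
        "{y, u} \<in> edges G" "{z, u} \<in> edges G" "{x, v} \<in> edges G"
        "{u, v} \<in> edges G" "{v, w} \<in> edges G" "{w, s} \<in> edges G"
    and "vertex_degree G y = 3" "vertex_degree G z = 3" "vertex_degree G s = 3"
    and "vertex_degree G x = 4" "vertex_degree G u = 4"
        "vertex_degree G v = 4" "vertex_degree G w = 4"
    and "e = {x, y}"
    and "chromatic_index (del_edge G e) = 4"
  shows "chromatic_index G = 4"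
proof -
  let ?H = "edges G - {{x, y}}"
  have edges_H: "edges (del_edge G e) = ?H"
    using assms(22) by (simp add: edges_del_edge)
  have fin: "finite {f \<in> edges G. a \<in> f}" if "vertex_degree G a > 0" for a
    using that card_ge_0_finite unfolding vertex_degree_def by blast
  obtain c where c: "proper ?H c"
    using chromatic_index_attained[OF pair_graph_del_edge[OF assms(1), of e]]
    unfolding assms(23) proper_edge_coloring_4 edges_H by blast
  have "\<exists>c. proper (edges G) c"
  proof (rule ccontr)
    assume none: "\<nexists>c. proper (edges G) c"
    have dist': "distinct [y, x, z, u]" "distinct [z, x, y, u]"
      using assms(5) by auto
    have at_y: "{f \<in> edges G. y \<in> f} = {{x, y}, {y, z}, {y, u}}"
      using incident_edges_eq[of y x z u "edges G"] dist'(1) assms(6,8,9,15)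
      by (simp add: vertex_degree_def insert_commute)
    have at_z: "{f \<in> edges G. z \<in> f} = {{x, z}, {y, z}, {z, u}}"
      using incident_edges_eq[of z x y u "edges G"] dist'(2) assms(7,8,10,16)
      by (simp add: vertex_degree_def insert_commute)
    interpret uncolourable_config "edges G" x y z u v w s
    proof unfold_locales
      show "\<forall>f\<in>edges G. \<exists>a b. f = {a, b}"
        unfolding edges_def by blast
      show "\<not> proper (edges G) c" for c
        using none by blast
    qed (fact assms at_y at_z)+
    \<comment> \<open>Deleting \<open>xy\<close> leaves three edges at \<open>x\<close>, and
      \<open>s\<close> has degree three, so each misses a colour.\<close>
    have x: "{f \<in> H. x \<in> f} = {f \<in> edges G. x \<in> f} - {{x, y}}"
      unfolding H_def by blast
    have "finite {f \<in> H. x \<in> f}" "card {f \<in> H. x \<in> f} < 4"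
      using assms(6,18) fin[of x] unfolding x by (simp_all add: vertex_degree_def)
    then obtain k where k: "k < 4" "\<not> sees H c x k"
      by (rule missing_colour)
    have s: "{f \<in> H. s \<in> f} = {f \<in> edges G. s \<in> f}"
      unfolding H_def by auto
    have "finite {f \<in> H. s \<in> f}" "card {f \<in> H. s \<in> f} < 4"
      using assms(17) fin[of s] unfolding s by (simp_all add: vertex_degree_def)
    then obtain m where m: "m < 4" "\<not> sees H c s m"
      by (rule missing_colour)
    show False
      using c[folded H_def] k m by (rule no_proper_colouring_H)
  qed
  then have le: "chromatic_index G \<le> 4"
    unfolding chromatic_index_def proper_edge_coloring_4[symmetric] by (rule Least_le)
  \<comment> \<open>For the lower bound, an optimal colouring of \<open>G\<close> restricts to
    \<open>G - e\<close>.\<close>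
  obtain d where "proper_edge_coloring G (chromatic_index G) d"
    using chromatic_index_attained[OF assms(1)] by blast
  then have "proper_edge_coloring (del_edge G e) (chromatic_index G) d"
    unfolding proper_edge_coloring_def edges_del_edge by blast
  then have "chromatic_index (del_edge G e) \<le> chromatic_index G"
    unfolding chromatic_index_def[of "del_edge G e"] by (intro Least_le exI)
  then show ?thesis
    using le assms(23) by simp
qed

end
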